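(* For every integer $n \ge 9$, the polynomial \[ J_{2n}(t) = \sum_{\pi \in \mathcal{J}_{2n}} t^{\operatorname{des}(\pi)} \] is $\gamma$-positive, where $\mathcal{J}_{2n}$ is the set of fixed-point-free involutions of $[2n]=\{1,\dots,2n\}$. That is, writing \[ J_{2n}(t) = \sum_{k=1}^{n} b_{2n,k}\, t^k (1+t)^{2n-2k}, \] all coefficients $b_{2n,k}$ are nonnegative.
   Context: For a permutation $\pi$ of $[m]$, its descent set is $\operatorname{DES}(\pi)=\{i\in[m-1] : \pi(i)>\pi(i+1)\}$ and $\operatorname{des}(\pi)=\#\operatorname{DES}(\pi)$. The polynomial $J_{2n}(t)$ is palindromic of center $n$, so it can be written uniquely in the form $\sum_k \gamma_k t^k (1+t)^{2n-2k}$; a palindromic polynomial is called $\gamma$-positive if all $\gamma_k\ge 0$. *)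

theory Defs
  imports "HOL-Combinatorics.Permutations" "HOL-Computational_Algebra.Polynomial"
begin

definition DES :: "nat \<Rightarrow> (nat \<Rightarrow> nat) \<Rightarrow> nat set" where
  "DES m \<pi> = {i \<in> {1..m - 1}. \<pi> i > \<pi> (i + 1)}"

definition des :: "nat \<Rightarrow> (nat \<Rightarrow> nat) \<Rightarrow> nat" where
  "des m \<pi> = card (DES m \<pi>)"

(* permutes fixes every point outside {1..m}, so each permutation of {1..m} is counted once;
   the involution and fixed-point conditions are imposed on {1..m} only. *)
definition fpf_involutions :: "nat \<Rightarrow> (nat \<Rightarrow> nat) set" where
  "fpf_involutions m =
     {\<pi>. \<pi> permutes {1..m} \<and> (\<forall>i\<in>{1..m}. \<pi> (\<pi> i) = i) \<and> (\<forall>i\<in>{1..m}. \<pi> i \<noteq> i)}"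

definition J_poly :: "nat \<Rightarrow> int poly" where
  "J_poly m = (\<Sum>\<pi>\<in>fpf_involutions m. monom 1 (des m \<pi>))"

(* The center is m / 2; in particular m = 2 * n corresponds to center n. *)
definition palindromic :: "nat \<Rightarrow> 'a::zero poly \<Rightarrow> bool" where
  "palindromic m p \<longleftrightarrow> degree p \<le> m \<and> (\<forall>i\<le>m. coeff p i = coeff p (m - i))"

(* The polynomials t^k (1 + t)^(m - 2k) are linearly independent (their lowest-order terms
   have distinct degrees), so the coefficients g k, for k at most m div 2, are unique. *)
definition gamma_positive :: "nat \<Rightarrow> 'a::linordered_idom poly \<Rightarrow> bool" where
  "gamma_positive m p \<longleftrightarrow> palindromic m p \<and>
     (\<exists>g. p = (\<Sum>k\<le>m div 2. smult (g k) (monom 1 k * [:1, 1:] ^ (m - 2 * k))) \<and>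
          (\<forall>k\<le>m div 2. 0 \<le> g k))"

end

theory Submission
  imports
    Defs
    "HOL-Library.Multiset"
    "HOL-Library.Product_Lexorder"
    "HOL-Library.FuncSet"
    "HOL-Computational_Algebra.Polynomial_FPS"
begin

text \<open>
  Let \<open>a\<close> be a weakly increasing map from \<open>{1..2n}\<close> to \<open>{0..r}\<close> that strictly increases at the
  descents of a fixed-point-free involution \<open>\<pi>\<close>. The words \<open>x \<mapsto> (a x, a (\<pi> x))\<close> are exactly the
  lexicographically sorted symmetric words of length \<open>2n\<close> in pairs of distinct letters, that is, the
  multisets of \<open>n\<close> two-element subsets of \<open>{0..r}\<close>. Counting both sides gives
  \<open>J_2n(t) / (1 - t)^(2n+1) = \<Sum>r. C(r(r+1)/2 + n - 1, n) t^r\<close>. Absorption for these binomial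
  coefficients makes the right-hand side \<open>A_n\<close> satisfy
  \<open>2(n+1) A_(n+1) = (\<theta>^2 + \<theta> + 2n) A_n\<close> with \<open>\<theta> = t d/dt\<close>, which becomes a three-term
  recurrence for the coefficients \<open>b_2n,k\<close>. Its coefficients are nonnegative except for
  \<open>k = n\<close>; there positivity is propagated, from \<open>n = 9\<close> on, by the inequalities
  \<open>4n b_2n,n \<le> 5 b_2n,n-1\<close> and \<open>n b_2n,n-1 \<le> 8 b_2n,n-2\<close>.
\<close>

subsection \<open>Involutions and multisets of pairs\<close>

definition mono_funs :: "nat \<Rightarrow> 'a::linorder set \<Rightarrow> (nat \<Rightarrow> 'a) set" where
  "mono_funs m S = {f \<in> {1..m} \<rightarrow>\<^sub>E S. mono_on {1..m} f}"

text \<open>A multiset over a linear order is determined by its sorted list, and a weakly increasing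
  map on \<open>{1..m}\<close> is such a list. This reduces the later counts to
  \<open>card_multisets_of_size\<close>.\<close>

lemma bij_betw_mono_funs_multisets:
  "bij_betw (\<lambda>f. image_mset f (mset_set {1..m})) (mono_funs m S) (multisets_of_size S m)"
proof (rule bij_betwI')
  have eq: "image_mset f (mset_set {1..m}) = mset (map f [1..<Suc m])" for f :: "nat \<Rightarrow> 'a"
    by (simp only: mset_map mset_upt atLeastLessThanSuc_atLeastAtMost)
  fix f g :: "nat \<Rightarrow> 'a"
  assume f: "f \<in> mono_funs m S" and g: "g \<in> mono_funs m S"
  have sorted: "sorted (map h [1..<Suc m])" if "mono_on {1..m} h" for h :: "nat \<Rightarrow> 'a"
    using that by (auto simp: sorted_iff_nth_mono mono_on_def simp del: upt_Suc)
  have "f = g" if "image_mset f (mset_set {1..m}) = image_mset g (mset_set {1..m})"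
  proof -
    from that have "sort (map f [1..<Suc m]) = sort (map g [1..<Suc m])"
      unfolding eq by (metis sorted_list_of_multiset_mset)
    moreover have "sorted (map f [1..<Suc m])" "sorted (map g [1..<Suc m])"
      using f g sorted unfolding mono_funs_def by blast+
    ultimately have "map f [1..<Suc m] = map g [1..<Suc m]"
      by (simp only: sorted_sort_id)
    then have "\<forall>x\<in>set [1..<Suc m]. f x = g x"
      by (simp only: map_eq_conv)
    then have "f x = g x" if "x \<in> {1..m}" for x
      using that by (simp del: upt_Suc)
    then show ?thesis
      using f g by (intro PiE_ext[of f "{1..m}" "\<lambda>_. S" g]) (auto simp: mono_funs_def)
  qed
  then show "image_mset f (mset_set {1..m}) = image_mset g (mset_set {1..m}) \<longleftrightarrow> f = g"
    by blast
next
  fix f assume "f \<in> mono_funs m S"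
  then show "image_mset f (mset_set {1..m}) \<in> multisets_of_size S m"
    by (auto simp: mono_funs_def multisets_of_size_def)
next
  fix M assume M: "M \<in> multisets_of_size S m"
  define xs where "xs = sorted_list_of_multiset M"
  \<comment> \<open>Lists are indexed from 0 and the maps from 1, hence
    \<open>i - 1\<close>.\<close>
  define f where "f = (\<lambda>i\<in>{1..m}. xs ! (i - 1))"
  have mset: "mset xs = M" and sorted: "sorted xs"
    by (simp_all add: xs_def)
  then have len: "length xs = m" and set: "set xs \<subseteq> S"
    using M by (auto simp: multisets_of_size_def)
  have "mono_on {1..m} f"
    using sorted len by (auto simp: mono_on_def f_def intro: sorted_nth_mono)
  moreover have "xs ! (i - 1) \<in> S" if "i \<in> {1..m}" for i
    using nth_mem[of "i - 1" xs] set len that by auto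
  then have "f \<in> {1..m} \<rightarrow>\<^sub>E S"
    by (auto simp: f_def)
  moreover have "map f [1..<Suc m] = xs"
    by (rule nth_equalityI) (auto simp: f_def len simp del: upt_Suc)
  then have "M = image_mset f (mset_set {1..m})"
    unfolding mset[symmetric] by (metis mset_map mset_upt atLeastLessThanSuc_atLeastAtMost)
  ultimately show "\<exists>f\<in>mono_funs m S. M = image_mset f (mset_set {1..m})"
    by (auto simp: mono_funs_def)
qed

lemma card_mono_funs: "finite S \<Longrightarrow> card (mono_funs m S) = (card S + m - 1) choose m"
  by (simp only: bij_betw_same_card[OF bij_betw_mono_funs_multisets] card_multisets_of_size)

section \<open>Counting weakly increasing maps with forced strict increases\<close>

definition strict_at :: "nat \<Rightarrow> nat \<Rightarrow> nat set \<Rightarrow> (nat \<Rightarrow> nat) set" where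
  "strict_at m r D = {a \<in> mono_funs m {..r}. \<forall>i\<in>D. a i < a (i + 1)}"

text \<open>Subtracting from \<open>a i\<close> the number \<open>h i\<close> of forced increases
  before \<open>i\<close> turns strict steps into weak ones and lowers the top value from
  \<open>r\<close> to \<open>r - card D\<close>. What remains is a count of arbitrary weakly
  increasing maps.\<close>

lemma card_strict_at:
  assumes D: "D \<subseteq> {1..m - 1}"
  shows "card (strict_at m r D) = (if card D \<le> r then (r - card D + m) choose m else 0)"
proof -
  define h where "h i = card {j \<in> D. j < i}" for i
  have fin: "finite D"
    using D finite_subset by blast
  have D_in: "1 \<le> i" "i + 1 \<le> m" if "i \<in> D" for i
    using subsetD[OF D that] by auto
  have h_Suc: "h (Suc i) = h i + (if i \<in> D then 1 else 0)" for i
  proof -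
    have "{j \<in> D. j < Suc i} = (if i \<in> D then insert i {j \<in> D. j < i} else {j \<in> D. j < i})"
      by (auto simp: less_Suc_eq)
    then show ?thesis
      using fin by (auto simp: h_def)
  qed
  have h_1: "h 1 = 0"
    using D by (auto simp: h_def)
  have h_m: "h m = card D"
  proof -
    have "{j \<in> D. j < m} = D"
      using D by force
    then show ?thesis
      by (simp add: h_def)
  qed
  have h_mono: "h i \<le> h j" if "i \<le> j" for i j
    unfolding h_def by (rule card_mono) (use fin that in auto)
  \<comment> \<open>Written with sums because natural subtraction truncates. The instance
    \<open>i = 1\<close> makes \<open>a i - h i\<close> exact, and \<open>j = m\<close> bounds it by
    \<open>r - card D\<close>.\<close>
  have gap: "a i + h j \<le> a j + h i" if a: "a \<in> strict_at m r D" and "1 \<le> i" "i \<le> j" "j \<le> m" for a i j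
    using \<open>i \<le> j\<close> \<open>j \<le> m\<close>
  proof (induction j rule: dec_induct)
    case (step j)
    have "a j \<le> a (Suc j)"
      using a step \<open>1 \<le> i\<close> by (auto simp: strict_at_def mono_funs_def mono_on_def)
    moreover have "a j < a (Suc j)" if "j \<in> D"
      using a that by (auto simp: strict_at_def)
    ultimately show ?case
      using step by (auto simp: h_Suc)
  qed simp
  have h_le: "h i \<le> a i" if "a \<in> strict_at m r D" "i \<in> {1..m}" for a i
    using gap[OF that(1), of 1 i] that(2) h_1 by auto
  show ?thesis
  proof (cases "card D \<le> r")
    case True
    have "bij_betw (\<lambda>c. \<lambda>i\<in>{1..m}. c i + h i) (mono_funs m {..r - card D}) (strict_at m r D)"
    proof (rule bij_betw_byWitness[where f' = "\<lambda>a. \<lambda>i\<in>{1..m}. a i - h i"])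
      show "\<forall>c\<in>mono_funs m {..r - card D}. (\<lambda>i\<in>{1..m}. (\<lambda>i\<in>{1..m}. c i + h i) i - h i) = c"
        by (auto simp: mono_funs_def fun_eq_iff PiE_def extensional_def)
      show "\<forall>a\<in>strict_at m r D. (\<lambda>i\<in>{1..m}. (\<lambda>i\<in>{1..m}. a i - h i) i + h i) = a"
        using h_le by (force simp: strict_at_def mono_funs_def fun_eq_iff PiE_def extensional_def)
      show "(\<lambda>c. \<lambda>i\<in>{1..m}. c i + h i) ` mono_funs m {..r - card D} \<subseteq> strict_at m r D"
      proof (clarify)
        fix c assume c: "c \<in> mono_funs m {..r - card D}"
        have c_mono: "c i \<le> c j" if "1 \<le> i" "i \<le> j" "j \<le> m" for i j
          using c that by (auto simp: mono_funs_def mono_on_def)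
        have "c i + h i \<le> r" if "i \<in> {1..m}" for i
        proof -
          have "c i \<le> r - card D" "h i \<le> h m"
            using c that h_mono by (auto simp: mono_funs_def)
          then show ?thesis
            using True h_m by simp
        qed
        moreover have "c i + h i < c (i + 1) + h (i + 1)" if "i \<in> D" for i
          using c_mono[of i "i + 1"] D_in[OF that] that by (simp add: h_Suc)
        moreover have "c i + h i \<le> c j + h j" if "1 \<le> i" "i \<le> j" "j \<le> m" for i j
          using c_mono[OF that] h_mono[OF that(2)] by simp
        moreover have "i \<in> {1..m}" "i + 1 \<in> {1..m}" if "i \<in> D" for i
          using D_in[OF that] by auto
        ultimately show "(\<lambda>i\<in>{1..m}. c i + h i) \<in> strict_at m r D"
          by (auto simp: strict_at_def mono_funs_def mono_on_def)
      qed
      show "(\<lambda>a. \<lambda>i\<in>{1..m}. a i - h i) ` strict_at m r D \<subseteq> mono_funs m {..r - card D}"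
      proof (clarify)
        fix a assume a: "a \<in> strict_at m r D"
        have le_r: "a i \<le> r" if "i \<in> {1..m}" for i
          using a that by (auto simp: strict_at_def mono_funs_def)
        have mono: "a i - h i \<le> a j - h j" if "1 \<le> i" "i \<le> j" "j \<le> m" for i j
          using gap[OF a that] h_le[OF a, of i] h_le[OF a, of j] that by auto
        have "a i - h i \<le> r - card D" if "i \<in> {1..m}" for i
          using mono[of i m] le_r[of m] that h_m by auto
        with mono show "(\<lambda>i\<in>{1..m}. a i - h i) \<in> mono_funs m {..r - card D}"
          by (auto simp: mono_funs_def mono_on_def)
      qed
    qed
    then show ?thesis
      using True bij_betw_same_card card_mono_funs[of "{..r - card D}" m] by fastforce
  next
    case False
    \<comment> \<open>Here \<open>D\<close> is nonempty, so position \<open>m\<close> exists; there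
      \<open>card D = h m \<le> a m \<le> r\<close> is contradictory.\<close>
    then have "m \<in> {1..m}"
      using D by (cases "m = 0") auto
    have "a \<notin> strict_at m r D" for a
    proof
      assume a: "a \<in> strict_at m r D"
      then have "a m \<le> r"
        using \<open>m \<in> {1..m}\<close> by (auto simp: strict_at_def mono_funs_def)
      with h_le[OF a \<open>m \<in> {1..m}\<close>] False h_m show False
        by simp
    qed
    then have "strict_at m r D = {}"
      by blast
    then show ?thesis
      using False by simp
  qed
qed

section \<open>Matching occurrences of a pair with occurrences of its swap\<close>

definition class_rank :: "(nat \<Rightarrow> 'a) \<Rightarrow> nat \<Rightarrow> nat \<Rightarrow> nat" where
  "class_rank L m x = card {z \<in> {1..m}. z < x \<and> L z = L x}"

text \<open>
  For \<open>L x = (a x, a (\<pi> x))\<close>, the involution matches the \<open>k\<close>-th occurrence of a pair with the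
  \<open>k\<close>-th occurrence of the swapped pair, so \<open>\<pi>\<close> can be read off from \<open>L\<close> and this rank.
\<close>

lemma class_rank_less:
  assumes "x \<in> {1..m}" "L x = L y" "x < y"
  shows "class_rank L m x < class_rank L m y"
  unfolding class_rank_def by (rule psubset_card_mono) (use assms in auto)

lemma class_rank_inj:
  assumes "x \<in> {1..m}" "y \<in> {1..m}" "L x = L y" "class_rank L m x = class_rank L m y"
  shows "x = y"
  using assms class_rank_less[of x m L y] class_rank_less[of y m L x]
  by (cases x y rule: linorder_cases) simp_all

text \<open>Ranks are distinct within a class and smaller than its size, so by counting every value
  is attained.\<close>

lemma class_rank_surj:
  "class_rank L m ` {z \<in> {1..m}. L z = p} = {..<card {z \<in> {1..m}. L z = p}}"
proof (rule card_subset_eq)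
  let ?S = "{z \<in> {1..m}. L z = p}"
  show "class_rank L m ` ?S \<subseteq> {..<card ?S}"
  proof (rule image_subsetI)
    fix x assume "x \<in> ?S"
    then show "class_rank L m x \<in> {..<card ?S}"
      unfolding class_rank_def lessThan_iff by (intro psubset_card_mono) auto
  qed
  have "inj_on (class_rank L m) ?S"
    by (rule inj_onI, rule class_rank_inj[of _ m _ L]) auto
  then show "card (class_rank L m ` ?S) = card {..<card ?S}"
    by (simp add: card_image)
qed simp

definition offdiag :: "nat \<Rightarrow> (nat \<times> nat) set" where
  "offdiag r = {p \<in> {..r} \<times> {..r}. fst p \<noteq> snd p}"

text \<open>The order on pairs behind \<open>mono_funs\<close> is the lexicographic one.\<close>

definition sym_words :: "nat \<Rightarrow> nat \<Rightarrow> (nat \<Rightarrow> nat \<times> nat) set" where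
  "sym_words m r = {L \<in> mono_funs m (offdiag r).
     \<forall>p. card {x \<in> {1..m}. L x = p} = card {x \<in> {1..m}. L x = prod.swap p}}"

lemma fpf_in:
  assumes "\<pi> \<in> fpf_involutions m" "x \<in> {1..m}"
  shows "\<pi> x \<in> {1..m}"
  using assms permutes_in_image[of \<pi> "{1..m}" x] unfolding fpf_involutions_def by blast

lemma fpf_invol:
  assumes "\<pi> \<in> fpf_involutions m" "x \<in> {1..m}"
  shows "\<pi> (\<pi> x) = x"
  using assms unfolding fpf_involutions_def by blast

context
  fixes m r :: nat and \<pi> a
  assumes \<pi>: "\<pi> \<in> fpf_involutions m" and a: "a \<in> strict_at m r (DES m \<pi>)"
begin

lemma strict_at_mono: "1 \<le> x \<Longrightarrow> x \<le> y \<Longrightarrow> y \<le> m \<Longrightarrow> a x \<le> a y"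
  using a by (auto simp: strict_at_def mono_funs_def mono_on_def)

text \<open>Every descent of \<pi> forces a strict increase of \<open>a\<close>, so a block on which
  \<open>a\<close> is constant contains no descent.\<close>

lemma fpf_increasing_on_block:
  assumes "1 \<le> x" "x < y" "y \<le> m" "a x = a y"
  shows "\<pi> x < \<pi> y"
proof -
  have step: "\<pi> z < \<pi> (Suc z)" if "x \<le> z" "z < y" for z
  proof -
    have "a x \<le> a z" "a z \<le> a (Suc z)" "a (Suc z) \<le> a y"
      using that assms strict_at_mono[of x z] strict_at_mono[of z "Suc z"] strict_at_mono[of "Suc z" y] by auto
    then have "z \<notin> DES m \<pi>"
      using a assms(4) by (auto simp: strict_at_def)
    moreover have "\<pi> z \<noteq> \<pi> (Suc z)"
      using fpf_invol[OF \<pi>, of z] fpf_invol[OF \<pi>, of "Suc z"] that assms by auto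
    ultimately show ?thesis
      using that assms by (auto simp: DES_def)
  qed
  have "\<pi> x < \<pi> z" if "Suc x \<le> z" "z \<le> y" for z
    using that
  proof (induction z rule: dec_induct)
    case base
    show ?case
      using step[of x] assms by simp
  next
    case (step z)
    then show ?case
      using \<open>\<And>z. x \<le> z \<Longrightarrow> z < y \<Longrightarrow> \<pi> z < \<pi> (Suc z)\<close>[of z] by simp
  qed
  with \<open>x < y\<close> show ?thesis
    by simp
qed

text \<open>Since \<pi> exchanges \<open>x\<close> and \<open>\<pi> x\<close>, it reverses their
  order, which is impossible inside one block.\<close>

lemma fpf_different_blocks:
  assumes x: "x \<in> {1..m}"
  shows "a x \<noteq> a (\<pi> x)"
proof
  assume eq: "a x = a (\<pi> x)"
  note bounds = x fpf_in[OF \<pi> x]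
  have "\<pi> x \<noteq> x"
    using \<pi> x unfolding fpf_involutions_def by blast
  then consider "x < \<pi> x" | "\<pi> x < x"
    by linarith
  then show False
  proof cases
    case 1
    then show False
      using fpf_increasing_on_block[of x "\<pi> x"] bounds eq fpf_invol[OF \<pi> x] by simp
  next
    case 2
    then show False
      using fpf_increasing_on_block[of "\<pi> x" x] bounds eq fpf_invol[OF \<pi> x] by simp
  qed
qed

text \<open>Being increasing on blocks, \<pi> sends the earlier members of the class of
  \<open>x\<close> injectively to earlier members of the class of \<open>\<pi> x\<close>. The same
  argument at \<open>\<pi> x\<close> gives the other inequality.\<close>

lemma class_rank_fpf:
  assumes L: "\<And>x. x \<in> {1..m} \<Longrightarrow> L x = (a x, a (\<pi> x))" and x: "x \<in> {1..m}"
  shows "class_rank L m (\<pi> x) = class_rank L m x"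
proof -
  have le: "class_rank L m x \<le> class_rank L m (\<pi> x)" if x: "x \<in> {1..m}" for x
  proof -
    have inj: "inj_on \<pi> {z \<in> {1..m}. z < x \<and> L z = L x}"
      by (rule inj_on_inverseI[of _ \<pi>]) (use fpf_invol[OF \<pi>] in blast)
    have "\<pi> ` {z \<in> {1..m}. z < x \<and> L z = L x} \<subseteq> {z \<in> {1..m}. z < \<pi> x \<and> L z = L (\<pi> x)}"
    proof (rule image_subsetI)
      fix z assume z: "z \<in> {z \<in> {1..m}. z < x \<and> L z = L x}"
      then have zm: "z \<in> {1..m}"
        by blast
      have eq: "a z = a x" "a (\<pi> z) = a (\<pi> x)"
        using z x L by auto
      have "\<pi> z < \<pi> x"
        using fpf_increasing_on_block[of z x] z x eq by simp
      moreover have "L (\<pi> z) = L (\<pi> x)"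
        using L[OF fpf_in[OF \<pi> zm]] L[OF fpf_in[OF \<pi> x]] fpf_invol[OF \<pi> zm] fpf_invol[OF \<pi> x] eq by simp
      ultimately show "\<pi> z \<in> {z \<in> {1..m}. z < \<pi> x \<and> L z = L (\<pi> x)}"
        using fpf_in[OF \<pi> zm] by blast
    qed
    then show ?thesis
      unfolding class_rank_def by (intro card_inj_on_le[OF inj]) auto
  qed
  show ?thesis
    using le[OF x] le[OF fpf_in[OF \<pi> x]] fpf_invol[OF \<pi> x] by simp
qed

text \<open>Ties in the first entry are sorted by the second because \<pi> increases on blocks. The
  symmetry is witnessed by \<pi> itself, which exchanges the positions of \<open>p\<close> with
  those of its swap.\<close>

lemma pair_word_in_sym_words: "(\<lambda>x\<in>{1..m}. (a x, a (\<pi> x))) \<in> sym_words m r"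
proof -
  let ?L = "\<lambda>x\<in>{1..m}. (a x, a (\<pi> x))"
  have range: "a x \<le> r" if "x \<in> {1..m}" for x
    using a that by (auto simp: strict_at_def mono_funs_def)
  have "?L \<in> {1..m} \<rightarrow>\<^sub>E offdiag r"
    using range fpf_in[OF \<pi>] fpf_different_blocks unfolding offdiag_def by (intro restrict_PiE_iff[THEN iffD2]) auto
  moreover have "mono_on {1..m} ?L"
  proof (rule mono_onI)
    fix x y assume xy: "x \<in> {1..m}" "y \<in> {1..m}" "x \<le> y"
    have "a (\<pi> x) \<le> a (\<pi> y)" if "a x = a y"
    proof -
      have "\<pi> x \<le> \<pi> y"
        using fpf_increasing_on_block[of x y] xy that by (cases "x = y") auto
      then show ?thesis
        using fpf_in[OF \<pi>] xy by (intro strict_at_mono) auto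
    qed
    moreover have "a x \<le> a y"
      using xy by (intro strict_at_mono) auto
    ultimately show "?L x \<le> ?L y"
      using xy by (cases "a x = a y") auto
  qed
  moreover have "card {x \<in> {1..m}. ?L x = p} = card {x \<in> {1..m}. ?L x = prod.swap p}" for p
  proof (rule bij_betw_same_card[of \<pi>])
    have sub: "\<pi> ` {x \<in> {1..m}. ?L x = q} \<subseteq> {x \<in> {1..m}. ?L x = prod.swap q}" for q
    proof (rule image_subsetI)
      fix x assume x: "x \<in> {x \<in> {1..m}. ?L x = q}"
      then have xm: "x \<in> {1..m}"
        by blast
      show "\<pi> x \<in> {x \<in> {1..m}. ?L x = prod.swap q}"
        using x fpf_in[OF \<pi> xm] fpf_invol[OF \<pi> xm] by auto
    qed
    show "bij_betw \<pi> {x \<in> {1..m}. ?L x = p} {x \<in> {1..m}. ?L x = prod.swap p}"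
      by (rule bij_betw_byWitness[where f' = \<pi>]) (use fpf_invol[OF \<pi>] sub[of p] sub[of "prod.swap p"] in auto)
  qed
  ultimately show ?thesis
    unfolding sym_words_def mono_funs_def by blast
qed

end

text \<open>First entries recover \<open>a\<close>; then \<open>\<pi> x\<close> is the only position
  carrying the swapped pair with the same rank as \<open>x\<close>.\<close>

lemma pair_word_inj:
  "inj_on (\<lambda>(\<pi>, a). \<lambda>x\<in>{1..m}. (a x, a (\<pi> x))) (SIGMA \<pi>:fpf_involutions m. strict_at m r (DES m \<pi>))"
proof (rule inj_onI, clarify)
  fix \<pi> a \<pi>' a'
  assume \<pi>: "\<pi> \<in> fpf_involutions m" and a: "a \<in> strict_at m r (DES m \<pi>)"
    and \<pi>': "\<pi>' \<in> fpf_involutions m" and a': "a' \<in> strict_at m r (DES m \<pi>')"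
    and eq: "(\<lambda>x\<in>{1..m}. (a x, a (\<pi> x))) = (\<lambda>x\<in>{1..m}. (a' x, a' (\<pi>' x)))"
  define L where "L = (\<lambda>x\<in>{1..m}. (a x, a (\<pi> x)))"
  have L: "L x = (a x, a (\<pi> x))" "L x = (a' x, a' (\<pi>' x))" if "x \<in> {1..m}" for x
    using that fun_cong[OF eq, of x] by (simp_all add: L_def)
  have "a x = a' x" if "x \<in> {1..m}" for x
    using L[OF that] by simp
  then have "a = a'"
    using a a' unfolding strict_at_def mono_funs_def
    by (intro PiE_ext[of a "{1..m}" "\<lambda>_. {..r}" a']) auto
  moreover have "\<pi> x = \<pi>' x" for x
  proof (cases "x \<in> {1..m}")
    case True
    note in1 = fpf_in[OF \<pi> True] and in2 = fpf_in[OF \<pi>' True]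
    have "L (\<pi> x) = L (\<pi>' x)"
      using L(1)[OF in1] L(2)[OF in2] L[OF True] fpf_invol[OF \<pi> True] fpf_invol[OF \<pi>' True] by simp
    moreover have "class_rank L m (\<pi> x) = class_rank L m (\<pi>' x)"
      using class_rank_fpf[OF \<pi> a L(1) True] class_rank_fpf[OF \<pi>' a' L(2) True] by simp
    ultimately show ?thesis
      by (rule class_rank_inj[OF in1 in2])
  next
    case False
    then show ?thesis
      using \<pi> \<pi>' unfolding fpf_involutions_def permutes_def by simp
  qed
  ultimately show "\<pi> = \<pi>' \<and> a = a'"
    by auto
qed

text \<open>The involution is rebuilt by joining occurrences of equal rank of a pair and of its
  swap. It has no fixed points because diagonal pairs are excluded.\<close>

lemma pair_word_surj:
  assumes L: "L \<in> sym_words m r"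
  shows "\<exists>\<pi>\<in>fpf_involutions m. \<exists>a\<in>strict_at m r (DES m \<pi>). L = (\<lambda>x\<in>{1..m}. (a x, a (\<pi> x)))"
proof -
  let ?match = "\<lambda>x y. y \<in> {1..m} \<and> L y = prod.swap (L x) \<and> class_rank L m y = class_rank L m x"
  have L_mono: "L x \<le> L y" if "1 \<le> x" "x \<le> y" "y \<le> m" for x y
    using L that by (auto simp: sym_words_def mono_funs_def mono_on_def)
  have L_in: "L x \<in> offdiag r" if "x \<in> {1..m}" for x
    using L that by (auto simp: sym_words_def mono_funs_def)
  \<comment> \<open>Existence: a class and its swapped class have equal size, so the same ranks
    occur in both.\<close>
  have ex: "\<exists>!y. ?match x y" if x: "x \<in> {1..m}" for x
  proof -
    have "class_rank L m x \<in> class_rank L m ` {z \<in> {1..m}. L z = L x}"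
      using x by blast
    also have "\<dots> = {..<card {z \<in> {1..m}. L z = prod.swap (L x)}}"
      unfolding class_rank_surj using L unfolding sym_words_def by blast
    also have "\<dots> = class_rank L m ` {z \<in> {1..m}. L z = prod.swap (L x)}"
      unfolding class_rank_surj ..
    finally obtain y where "?match x y"
      by force
    moreover have "y = y'" if "?match x y" "?match x y'" for y y'
      using that class_rank_inj[of y m y' L] by metis
    ultimately show ?thesis
      by blast
  qed
  define \<pi> where "\<pi> x = (if x \<in> {1..m} then THE y. ?match x y else x)" for x
  define a where "a = (\<lambda>x\<in>{1..m}. fst (L x))"
  have match: "?match x (\<pi> x)" if "x \<in> {1..m}" for x
    using theI'[OF ex[OF that]] that by (simp add: \<pi>_def)
  have \<pi>_in: "\<pi> x \<in> {1..m}" and L_\<pi>: "L (\<pi> x) = prod.swap (L x)"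
    and rank: "class_rank L m (\<pi> x) = class_rank L m x" if "x \<in> {1..m}" for x
    using match[OF that] by simp_all
  have invol: "\<pi> (\<pi> x) = x" if "x \<in> {1..m}" for x
    by (rule class_rank_inj[of _ m _ L]) (use that \<pi>_in L_\<pi> rank in simp_all)
  have "\<pi> permutes {1..m}"
    unfolding permutes_def using invol \<pi>_def by metis
  moreover have "\<pi> x \<noteq> x" if "x \<in> {1..m}" for x
    using L_\<pi>[OF that] L_in[OF that] by (cases "L x") (auto simp: offdiag_def)
  ultimately have \<pi>: "\<pi> \<in> fpf_involutions m"
    using invol by (simp add: fpf_involutions_def)
  have "L x = (a x, a (\<pi> x))" if "x \<in> {1..m}" for x
    using that \<pi>_in[OF that] L_\<pi>[OF that] by (simp add: a_def)
  then have word: "L = (\<lambda>x\<in>{1..m}. (a x, a (\<pi> x)))"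
    using L by (auto simp: sym_words_def mono_funs_def fun_eq_iff PiE_def extensional_def)
  have a_mono: "a x \<le> a y" if "1 \<le> x" "x \<le> y" "y \<le> m" for x y
    using L_mono[OF that] that by (auto simp: a_def less_eq_prod_def)
  \<comment> \<open>If \<open>a\<close> were constant across a descent, sortedness at
    \<open>i\<close>, \<open>i + 1\<close> and at their images in reversed order would force
    \<open>L i = L (i + 1)\<close>. Then the rank grows from \<open>i\<close> to
    \<open>i + 1\<close> but drops between the images, although \<pi> preserves ranks.\<close>
  have "a i < a (i + 1)" if "i \<in> DES m \<pi>" for i
  proof (rule ccontr)
    assume "\<not> a i < a (i + 1)"
    have i: "1 \<le> i" "i + 1 \<le> m" and desc: "\<pi> (i + 1) < \<pi> i"
      using that by (auto simp: DES_def)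
    then have im: "i \<in> {1..m}" "i + 1 \<in> {1..m}"
      by auto
    have fst_eq: "fst (L i) = fst (L (i + 1))"
      using a_mono[of i "i + 1"] i im \<open>\<not> a i < a (i + 1)\<close> by (simp add: a_def)
    have "L i \<le> L (i + 1)"
      using i by (intro L_mono) auto
    moreover have "L (\<pi> (i + 1)) \<le> L (\<pi> i)"
      using desc \<pi>_in[OF im(1)] \<pi>_in[OF im(2)] by (intro L_mono) auto
    then have "snd (L (i + 1)) \<le> snd (L i)"
      unfolding L_\<pi>[OF im(1)] L_\<pi>[OF im(2)] by (auto simp: less_eq_prod_def)
    ultimately have eq: "L i = L (i + 1)"
      using fst_eq by (auto simp: less_eq_prod_def prod_eq_iff)
    have "class_rank L m (\<pi> (i + 1)) < class_rank L m (\<pi> i)"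
      by (rule class_rank_less) (use desc \<pi>_in L_\<pi> im eq in auto)
    moreover have "class_rank L m i < class_rank L m (i + 1)"
      by (rule class_rank_less) (use im eq in auto)
    ultimately show False
      using rank im by simp
  qed
  moreover have "a \<in> {1..m} \<rightarrow>\<^sub>E {..r}"
    using L_in by (fastforce simp: a_def offdiag_def)
  ultimately have "a \<in> strict_at m r (DES m \<pi>)"
    using a_mono by (auto simp: strict_at_def mono_funs_def mono_on_def)
  with \<pi> word show ?thesis
    by blast
qed

lemma bij_betw_pair_word:
  "bij_betw (\<lambda>(\<pi>, a). \<lambda>x\<in>{1..m}. (a x, a (\<pi> x)))
     (SIGMA \<pi>:fpf_involutions m. strict_at m r (DES m \<pi>)) (sym_words m r)"
  unfolding bij_betw_def
proof (intro conjI pair_word_inj subset_antisym subsetI)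
  fix L assume "L \<in> (\<lambda>(\<pi>, a). \<lambda>x\<in>{1..m}. (a x, a (\<pi> x))) `
     (SIGMA \<pi>:fpf_involutions m. strict_at m r (DES m \<pi>))"
  then show "L \<in> sym_words m r"
    using pair_word_in_sym_words by auto
next
  fix L assume "L \<in> sym_words m r"
  then show "L \<in> (\<lambda>(\<pi>, a). \<lambda>x\<in>{1..m}. (a x, a (\<pi> x))) `
     (SIGMA \<pi>:fpf_involutions m. strict_at m r (DES m \<pi>))"
    using pair_word_surj[of L m r] by force
qed

section \<open>From symmetric words to multisets of two-element subsets\<close>

definition sym_multisets :: "nat \<Rightarrow> nat \<Rightarrow> (nat \<times> nat) multiset set" where
  "sym_multisets m r = {M \<in> multisets_of_size (offdiag r) m. \<forall>p. count M p = count M (prod.swap p)}"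

lemma bij_betw_sym_words: "bij_betw (\<lambda>f. image_mset f (mset_set {1..m})) (sym_words m r) (sym_multisets m r)"
  unfolding sym_words_def sym_multisets_def
  by (rule bij_betw_Collect[OF bij_betw_mono_funs_multisets]) (simp add: count_image_mset_eq_card_vimage)

text \<open>Without diagonal pairs, a swap-invariant multiset is determined by its increasingly
  oriented half.\<close>

lemma bij_betw_sym_multisets:
  "bij_betw (\<lambda>N. N + image_mset prod.swap N) (multisets_of_size {(i, j). i < j \<and> j \<le> r} n) (sym_multisets (2 * n) r)"
proof (rule bij_betw_byWitness[where f' = "filter_mset (\<lambda>(i, j). i < j)"])
  have count_swap: "count (image_mset prod.swap N) p = count N (prod.swap p)" for N :: "(nat \<times> nat) multiset" and p
    by (induction N) (auto simp: prod_eq_iff)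
  let ?T = "{(i, j). i < j \<and> j \<le> r}"
  show "\<forall>N\<in>multisets_of_size ?T n. filter_mset (\<lambda>(i, j). i < j) (N + image_mset prod.swap N) = N"
  proof
    fix N assume "N \<in> multisets_of_size ?T n"
    then have N: "count N (i, j) = 0" if "\<not> i < j" for i j
      using that by (auto simp: multisets_of_size_def count_eq_zero_iff)
    show "filter_mset (\<lambda>(i, j). i < j) (N + image_mset prod.swap N) = N"
      by (rule multiset_eqI) (auto simp: count_swap N split: prod.splits)
  qed
  have split: "filter_mset (\<lambda>(i, j). i < j) M + image_mset prod.swap (filter_mset (\<lambda>(i, j). i < j) M) = M"
    if "M \<in> sym_multisets (2 * n) r" for M
  proof (rule multiset_eqI)
    fix p :: "nat \<times> nat"
    obtain i j where p: "p = (i, j)"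
      by fastforce
    have sym: "count M (i, j) = count M (j, i)"
      using that by (auto simp: sym_multisets_def dest: spec[of _ "(i, j)"])
    have "count M (i, i) = 0"
      using that by (auto simp: sym_multisets_def multisets_of_size_def offdiag_def count_eq_zero_iff)
    then show "count (filter_mset (\<lambda>(i, j). i < j) M + image_mset prod.swap (filter_mset (\<lambda>(i, j). i < j) M)) p = count M p"
      using sym by (cases i j rule: linorder_cases) (simp_all add: p count_swap)
  qed
  then show "\<forall>M\<in>sym_multisets (2 * n) r. filter_mset (\<lambda>(i, j). i < j) M
      + image_mset prod.swap (filter_mset (\<lambda>(i, j). i < j) M) = M"
    by blast
  show "(\<lambda>N. N + image_mset prod.swap N) ` multisets_of_size ?T n \<subseteq> sym_multisets (2 * n) r"
    by (force simp: sym_multisets_def multisets_of_size_def offdiag_def count_swap)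
  show "filter_mset (\<lambda>(i, j). i < j) ` sym_multisets (2 * n) r \<subseteq> multisets_of_size ?T n"
  proof (rule image_subsetI)
    fix M assume M: "M \<in> sym_multisets (2 * n) r"
    have "size M = 2 * size (filter_mset (\<lambda>(i, j). i < j) M)"
      using arg_cong[OF split[OF M], of size] by simp
    moreover have "size M = 2 * n" "set_mset M \<subseteq> offdiag r"
      using M by (simp_all add: sym_multisets_def multisets_of_size_def)
    ultimately show "filter_mset (\<lambda>(i, j). i < j) M \<in> multisets_of_size ?T n"
      by (auto simp: multisets_of_size_def offdiag_def)
  qed
qed

lemma card_ordered_pairs: "finite {(i, j). i < j \<and> j \<le> r}" "card {(i, j). i < j \<and> j \<le> r} = r * (r + 1) div 2" for r :: nat
proof -
  have eq: "{(i, j). i < j \<and> j \<le> r} = prod.swap ` (SIGMA j:{..r}. {..<j})"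
    by force
  show "finite {(i, j). i < j \<and> j \<le> r}"
    unfolding eq by auto
  have "card {(i, j). i < j \<and> j \<le> r} = (\<Sum>j\<le>r. j)"
    unfolding eq by (simp add: card_image)
  also have "\<dots> = r * (r + 1) div 2"
    by (simp add: gauss_sum_nat atMost_atLeast0)
  finally show "card {(i, j). i < j \<and> j \<le> r} = r * (r + 1) div 2" .
qed

lemma finite_fpf_involutions: "finite (fpf_involutions m)"
  by (rule finite_subset[OF _ finite_permutations[of "{1..m}"]]) (auto simp: fpf_involutions_def)

lemma finite_strict_at: "finite (strict_at m r D)"
  by (rule finite_subset[of _ "{1..m} \<rightarrow>\<^sub>E {..r}"]) (auto simp: strict_at_def mono_funs_def intro: finite_PiE)

text \<open>Double counting of the pairs \<open>(\<pi>, a)\<close>: one side sums over \<pi>, the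
  other passes through words and symmetric multisets to multisets of \<open>n\<close> two-element
  subsets of \<open>{0..r}\<close>.\<close>

lemma sum_strict_at:
  "(\<Sum>\<pi>\<in>fpf_involutions (2 * n). if des (2 * n) \<pi> \<le> r then (r - des (2 * n) \<pi> + 2 * n) choose (2 * n) else 0)
     = (r * (r + 1) div 2 + n - 1) choose n"
proof -
  have "(r * (r + 1) div 2 + n - 1) choose n = card (multisets_of_size {(i, j). i < j \<and> j \<le> r} n)"
    by (simp only: card_multisets_of_size card_ordered_pairs)
  also have "\<dots> = card (sym_multisets (2 * n) r)"
    by (rule bij_betw_same_card[OF bij_betw_sym_multisets])
  also have "\<dots> = card (sym_words (2 * n) r)"
    by (rule bij_betw_same_card[OF bij_betw_sym_words, symmetric])
  also have "\<dots> = card (SIGMA \<pi>:fpf_involutions (2 * n). strict_at (2 * n) r (DES (2 * n) \<pi>))"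
    by (rule bij_betw_same_card[OF bij_betw_pair_word, symmetric])
  also have "\<dots> = (\<Sum>\<pi>\<in>fpf_involutions (2 * n). card (strict_at (2 * n) r (DES (2 * n) \<pi>)))"
    by (simp add: finite_fpf_involutions finite_strict_at)
  also have "\<dots> = (\<Sum>\<pi>\<in>fpf_involutions (2 * n). if des (2 * n) \<pi> \<le> r then (r - des (2 * n) \<pi> + 2 * n) choose (2 * n) else 0)"
    by (rule sum.cong[OF refl], subst card_strict_at) (auto simp: DES_def des_def)
  finally show ?thesis ..
qed

subsection \<open>The recurrence for the gamma coefficients\<close>

context
  includes fps_syntax
begin

text \<open>
  The operator \<open>X\<^sup>2 D\<^sup>2 + 2 X D + c\<close> on \<open>A\<close>, transported to the numerator \<open>P = (1 - X)^s A\<close>;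
  see \<open>gen_step_correct\<close>.
\<close>

definition gen_step :: "nat \<Rightarrow> rat \<Rightarrow> rat fps \<Rightarrow> rat fps" where
  "gen_step s c P =
     fps_X^2 * ((1 - fps_X) * fps_deriv ((1 - fps_X) * fps_deriv P + of_nat s * P)
       + of_nat (s + 1) * ((1 - fps_X) * fps_deriv P + of_nat s * P))
     + 2 * fps_X * (1 - fps_X) * ((1 - fps_X) * fps_deriv P + of_nat s * P)
     + fps_const c * (1 - fps_X)^2 * P"

text \<open>The extra factor \<open>f\<close> avoids the exponent \<open>k - 1\<close> and hence a
  special case at \<open>k = 0\<close>.\<close>

lemma times_fps_deriv_power:
  fixes f :: "'a::comm_ring_1 fps"
  shows "f * fps_deriv (f ^ k) = of_nat k * fps_deriv f * f ^ k"
proof (induction k)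
  case (Suc k)
  have "f * fps_deriv (f ^ Suc k) = f ^ Suc k * fps_deriv f + f * (f * fps_deriv (f ^ k))"
    by (simp add: algebra_simps)
  also have "\<dots> = of_nat (Suc k) * fps_deriv f * f ^ Suc k"
    unfolding Suc.IH by (simp add: algebra_simps)
  finally show ?case .
qed simp

lemma gen_step_correct:
  fixes A :: "rat fps"
  shows "(1 - fps_X)^(s + 2) * (fps_X^2 * fps_deriv (fps_deriv A) + 2 * fps_X * fps_deriv A + fps_const c * A)
       = gen_step s c ((1 - fps_X)^s * A)"
proof -
  let ?Y = "1 - fps_X :: rat fps"
  \<comment> \<open>Differentiating a series acts on its numerator as
    \<open>P \<mapsto> (1 - X) P' + s P\<close>, at the cost of one more factor
    \<open>1 - X\<close>. The second derivative uses this at \<open>s\<close> and then at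
    \<open>s + 1\<close>.\<close>
  have 1: "?Y * fps_deriv (?Y^s * B) + of_nat s * (?Y^s * B) = ?Y^Suc s * fps_deriv B" for s B
  proof -
    have "?Y * fps_deriv (?Y^s * B) = (?Y * fps_deriv (?Y^s)) * B + ?Y^Suc s * fps_deriv B"
      by (simp add: algebra_simps)
    then show ?thesis
      unfolding times_fps_deriv_power by (simp add: algebra_simps)
  qed
  show ?thesis
    unfolding gen_step_def 1 Suc_eq_plus1[symmetric] by (simp add: algebra_simps power2_eq_square)
qed

lemma gen_step_sum: "gen_step s c (\<Sum>k\<in>S. fps_const (b k) * f k) = (\<Sum>k\<in>S. fps_const (b k) * gen_step s c (f k))"
proof (induction S rule: infinite_finite_induct)
  case (insert x F)
  have "gen_step s c (fps_const a * p + q) = fps_const a * gen_step s c p + gen_step s c q" for a p q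
    unfolding gen_step_def by (simp add: algebra_simps)
  with insert show ?case by simp
qed (simp_all add: gen_step_def)

definition gamma_basis :: "nat \<Rightarrow> nat \<Rightarrow> rat fps" where
  "gamma_basis n k = fps_X^k * (1 + fps_X)^(2 * n - 2 * k)"

text \<open>The three families are the recurrence coefficients, taken in \<open>rat\<close> so that
  differences may be negative. In particular \<open>gamma_rec1 n n = 2 - 6n\<close>, while
  \<open>gamma_rec2 n n = 0\<close> removes the term of index \<open>n + 2\<close>.\<close>

definition gamma_rec0 :: "nat \<Rightarrow> nat \<Rightarrow> rat" where
  "gamma_rec0 n k = of_nat k * (of_nat k + 1) + 2 * of_nat n"
definition gamma_rec1 :: "nat \<Rightarrow> nat \<Rightarrow> rat" where
  "gamma_rec1 n k = 2 + 2 * of_nat k * (4 * of_nat n - 4 * of_nat k - 3)"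
definition gamma_rec2 :: "nat \<Rightarrow> nat \<Rightarrow> rat" where
  "gamma_rec2 n k = 8 * (of_nat n - of_nat k) * (2 * of_nat n - 2 * of_nat k - 1)"

text \<open>With \<open>P = X^k (1 + X)^(2d)\<close> and \<open>d = n - k\<close>, both derivatives
  are rational multiples of \<open>P\<close>. Multiplying by \<open>(1 + X)^2\<close> clears
  denominators, leaving a polynomial identity in \<open>X\<close>, \<kappa>, \<delta>; the factor is
  cancelled at the end.\<close>

lemma gen_step_gamma_basis:
  assumes "k \<le> n"
  shows "gen_step (2 * n + 1) (2 * of_nat n) (gamma_basis n k) =
     fps_const (gamma_rec0 n k) * gamma_basis (Suc n) k + fps_const (gamma_rec1 n k) * gamma_basis (Suc n) (k + 1)
     + fps_const (gamma_rec2 n k) * gamma_basis (Suc n) (k + 2)"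
proof -
  let ?X = "fps_X :: rat fps"
  let ?W = "1 + ?X"
  obtain d where n: "n = k + d"
    using assms le_Suc_ex by blast
  define K where "K = ?X ^ k"
  define V where "V = ?W ^ (2 * d)"
  define P where "P = gamma_basis n k"
  define \<kappa> where "\<kappa> = (of_nat k :: rat fps)"
  define \<delta> where "\<delta> = (of_nat d :: rat fps)"
  have P: "P = K * V"
    by (simp add: P_def gamma_basis_def K_def V_def n)
  have W0: "?W \<noteq> 0"
    by (metis fps_add_nth fps_X_nth fps_one_nth fps_zero_nth add_0_right zero_neq_one)
  have K1: "?X * fps_deriv K = \<kappa> * K"
    unfolding \<kappa>_def K_def times_fps_deriv_power by simp
  have V1: "?W * fps_deriv V = 2 * \<delta> * V"
    unfolding \<delta>_def V_def times_fps_deriv_power by simp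
  have kd: "fps_deriv \<kappa> = 0" "fps_deriv \<delta> = 0"
    by (simp_all add: \<kappa>_def \<delta>_def flip: fps_of_nat)
  have P1: "?X * ?W * fps_deriv P = (\<kappa> * ?W + 2 * \<delta> * ?X) * P"
  proof -
    have "?X * ?W * fps_deriv P = (?X * fps_deriv K) * V * ?W + (?W * fps_deriv V) * K * ?X"
      by (simp add: P algebra_simps)
    then show ?thesis
      unfolding K1 V1 by (simp add: P algebra_simps)
  qed
  \<comment> \<open>This comes from differentiating \<open>P1\<close>, multiplying by
    \<open>X (1 + X)\<close> and substituting \<open>P1\<close> again.\<close>
  have P2: "(?X * ?W)^2 * fps_deriv (fps_deriv P) =
    ((\<kappa> * ?W + 2 * \<delta> * ?X)^2 - \<kappa> * ?W^2 - 2 * \<delta> * ?X^2) * P"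
  proof -
    have "fps_deriv (?X * ?W * fps_deriv P) = fps_deriv ((\<kappa> * ?W + 2 * \<delta> * ?X) * P)"
      using P1 by simp
    then have "(1 + 2 * ?X) * fps_deriv P + ?X * ?W * fps_deriv (fps_deriv P)
       = (\<kappa> * ?W + 2 * \<delta> * ?X) * fps_deriv P + (\<kappa> + 2 * \<delta>) * P"
      by (simp add: kd numeral_fps_const algebra_simps)
    then show ?thesis
      using P1 by algebra
  qed
  have const: "fps_const (gamma_rec0 n k) = \<kappa> * (\<kappa> + 1) + 2 * (\<kappa> + \<delta>)"
     "fps_const (gamma_rec1 n k) = 2 + 2 * \<kappa> * (4 * \<delta> - 3)"
     "fps_const (gamma_rec2 n k) = 8 * \<delta> * (2 * \<delta> - 1)"
     "fps_const (2 * of_nat n) = 2 * (\<kappa> + \<delta>)" "of_nat (2 * n + 1) = 2 * (\<kappa> + \<delta>) + 1"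
    by (simp_all add: gamma_rec0_def gamma_rec1_def gamma_rec2_def \<kappa>_def \<delta>_def n algebra_simps numeral_fps_const flip: fps_of_nat)
  have g1: "gamma_basis (Suc n) k = ?W^2 * P" "gamma_basis (Suc n) (k + 1) = ?X * P"
    by (simp_all add: gamma_basis_def n P K_def V_def mult_ac power2_eq_square)
  \<comment> \<open>For \<open>d = 0\<close> the exponent in
    \<open>gamma_basis (Suc n) (k + 2)\<close> truncates, but then \<delta> = 0 and both sides
    vanish.\<close>
  have g2: "?W^2 * (8 * \<delta> * (2 * \<delta> - 1) * gamma_basis (Suc n) (k + 2)) = 8 * \<delta> * (2 * \<delta> - 1) * ?X^2 * P"
    by (cases d) (simp_all add: gamma_basis_def n P K_def V_def \<delta>_def mult_ac power2_eq_square)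
  have "?W^2 * gen_step (2 * n + 1) (2 * of_nat n) P =
     ?W^2 * ((\<kappa> * (\<kappa> + 1) + 2 * (\<kappa> + \<delta>)) * (?W^2 * P) + (2 + 2 * \<kappa> * (4 * \<delta> - 3)) * (?X * P))
     + 8 * \<delta> * (2 * \<delta> - 1) * ?X^2 * P"
  proof -
    define s where "s = 2 * (\<kappa> + \<delta>) + 1"
    have s: "of_nat (2 * n + 1) = s" "fps_const (2 * of_nat n) = s - 1" "of_nat (2 * n + 1 + 1) = s + 1"
            "fps_deriv s = 0"
      using const by (simp_all add: s_def kd numeral_fps_const)
    have step: "gen_step (2 * n + 1) (2 * of_nat n) P = ?X^2 * fps_deriv (fps_deriv P) * (1 - ?X)^2
        + ?X * fps_deriv P * (?X * (1 - ?X) * (2 * s) + 2 * (1 - ?X)^2)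
        + P * ((s + 1) * s * ?X^2 + 2 * ?X * (1 - ?X) * s + (s - 1) * (1 - ?X)^2)"
      unfolding gen_step_def s(1-3) by (simp add: s(4) algebra_simps power2_eq_square)
    have "?W^2 * gen_step (2 * n + 1) (2 * of_nat n) P = 
          ((?X * ?W)^2 * fps_deriv (fps_deriv P)) * (1 - ?X)^2
        + (?X * ?W * fps_deriv P) * ?W * (?X * (1 - ?X) * (2 * s) + 2 * (1 - ?X)^2)
        + ?W^2 * P * ((s + 1) * s * ?X^2 + 2 * ?X * (1 - ?X) * s + (s - 1) * (1 - ?X)^2)"
      unfolding step by algebra
    then show ?thesis
      unfolding P1 P2 s_def by algebra
  qed
  also have "\<dots> = ?W^2 * ((\<kappa> * (\<kappa> + 1) + 2 * (\<kappa> + \<delta>)) * gamma_basis (Suc n) k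
     + (2 + 2 * \<kappa> * (4 * \<delta> - 3)) * gamma_basis (Suc n) (k + 1) + 8 * \<delta> * (2 * \<delta> - 1) * gamma_basis (Suc n) (k + 2))"
    unfolding g1 distrib_left[of "?W^2"] g2 by (simp add: algebra_simps)
  finally have "gen_step (2 * n + 1) (2 * of_nat n) P = (\<kappa> * (\<kappa> + 1) + 2 * (\<kappa> + \<delta>)) * gamma_basis (Suc n) k
     + (2 + 2 * \<kappa> * (4 * \<delta> - 3)) * gamma_basis (Suc n) (k + 1) + 8 * \<delta> * (2 * \<delta> - 1) * gamma_basis (Suc n) (k + 2)"
    using W0 by simp
  then show ?thesis
    unfolding P_def const .
qed

text \<open>The division puts the values in \<open>rat\<close>; integrality is recovered in
  \<open>gamma_coeff_in_Ints\<close>. The guards keep truncated indices from contributing.\<close>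

primrec gamma_coeff :: "nat \<Rightarrow> nat \<Rightarrow> rat" where
  "gamma_coeff 0 k = (if k = 0 then 1 else 0)"
| "gamma_coeff (Suc n) k = (gamma_rec0 n k * gamma_coeff n k
     + (if 1 \<le> k then gamma_rec1 n (k - 1) * gamma_coeff n (k - 1) else 0)
     + (if 2 \<le> k then gamma_rec2 n (k - 2) * gamma_coeff n (k - 2) else 0)) / (2 * of_nat (Suc n))"

declare gamma_coeff.simps(2) [simp del]

text \<open>The only case beyond the induction hypothesis is index \<open>n + 2\<close> in row
  \<open>n + 1\<close>, where \<open>gamma_rec2 n n = 0\<close>.\<close>

lemma gamma_coeff_eq_0: "k > n \<Longrightarrow> gamma_coeff n k = 0"
proof (induction n arbitrary: k)
  case (Suc n)
  consider "k = n + 2" | "k > n + 2"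
    using Suc.prems by linarith
  then show ?case
    by cases (use Suc in \<open>auto simp: gamma_coeff.simps(2) gamma_rec2_def\<close>)
qed simp

text \<open>\<open>gamma_rec0 0 0 = 0\<close> kills the constant term at the first step. This lets
  the final expansion start at \<open>k = 1\<close>.\<close>

lemma gamma_coeff_0_right: "gamma_coeff (Suc n) 0 = 0"
  by (induction n) (simp_all add: gamma_coeff.simps(2) gamma_rec0_def)

definition pairs_gf :: "nat \<Rightarrow> rat fps" where
  "pairs_gf n = Abs_fps (\<lambda>r. of_nat ((r * (r + 1) div 2 + n - 1) choose n))"

text \<open>The operator multiplies the coefficient of \<open>X^r\<close> by
  \<open>r(r+1) + 2n = 2(N + n)\<close> with \<open>N = r(r+1)/2\<close>, so coefficientwise this is
  binomial absorption.\<close>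

lemma pairs_gf_Suc:
  "fps_const (2 * of_nat (Suc n)) * pairs_gf (Suc n) = 
     fps_X^2 * fps_deriv (fps_deriv (pairs_gf n)) + 2 * fps_X * fps_deriv (pairs_gf n)
     + fps_const (2 * of_nat n) * pairs_gf n"
proof (rule fps_ext)
  fix r :: nat
  define N where "N = r * (r + 1) div 2"
  have N2: "2 * N = r * (r + 1)"
    unfolding N_def by (rule dvd_mult_div_cancel) simp
  have "Suc n * ((N + n) choose Suc n) = (N + n) * ((N + n - 1) choose n)"
    by (rule binomial_absorption)
  then have "2 * Suc n * ((N + n) choose Suc n) = (r * (r + 1) + 2 * n) * ((N + n - 1) choose n)"
    unfolding N2[symmetric] by (simp only: mult.assoc distrib_left[of 2, symmetric])
  then have "of_nat (2 * Suc n * ((N + n) choose Suc n)) 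
      = (of_nat ((r * (r + 1) + 2 * n) * ((N + n - 1) choose n)) :: rat)"
    by (rule arg_cong)
  then have eq: "2 * of_nat (Suc n) * of_nat ((N + n) choose Suc n) =
    (of_nat r * (of_nat r + 1) + 2 * of_nat n) * (of_nat ((N + n - 1) choose n) :: rat)"
    by (simp add: algebra_simps)
  have d: "(fps_X^2 * fps_deriv (fps_deriv f)) $ r = of_nat r * (of_nat r - 1) * f $ r"
       "(2 * fps_X * fps_deriv f) $ r = 2 * of_nat r * f $ r" for f :: "rat fps"
  proof -
    show "(2 * fps_X * fps_deriv f) $ r = 2 * of_nat r * f $ r"
      by (cases r) (simp_all add: mult.assoc numeral_fps_const)
    consider "r = 0" | "r = 1" | r' where "r = r' + 2"
      by (metis One_nat_def add_2_eq_Suc' not0_implies_Suc)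
    then show "(fps_X^2 * fps_deriv (fps_deriv f)) $ r = of_nat r * (of_nat r - 1) * f $ r"
    proof cases
      case 3
      then have "(fps_X^2 * fps_deriv (fps_deriv f)) $ r = of_nat (r' + 1) * of_nat (r' + 2) * f $ r"
        by (simp add: fps_X_power_mult_nth)
      then show ?thesis
        using 3 by (simp add: algebra_simps)
    qed (auto simp: fps_X_power_mult_nth)
  qed
  show "(fps_const (2 * of_nat (Suc n)) * pairs_gf (Suc n)) $ r = (fps_X^2 * fps_deriv (fps_deriv (pairs_gf n)) + 2 * fps_X * fps_deriv (pairs_gf n)
     + fps_const (2 * of_nat n) * pairs_gf n) $ r"
  proof -
    have "(fps_const (2 * of_nat (Suc n)) * pairs_gf (Suc n)) $ r
        = (of_nat r * (of_nat r + 1) + 2 * of_nat n) * pairs_gf n $ r"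
      using eq by (simp add: pairs_gf_def N_def)
    then show ?thesis
      unfolding fps_add_nth d by (simp add: algebra_simps)
  qed
qed

text \<open>Regroups the images of the basis elements under \<open>gen_step\<close> by the index of
  the target basis element.\<close>

lemma sum_shifted_terms:
  fixes a b c g :: "nat \<Rightarrow> 'a::comm_ring_1"
  assumes "\<And>k. k > n \<Longrightarrow> a k = 0" "\<And>k. k > n \<Longrightarrow> b k = 0" "\<And>k. k > n \<Longrightarrow> c k = 0"
  shows "(\<Sum>k\<le>n + 2. (a k + (if 1 \<le> k then b (k - 1) else 0) + (if 2 \<le> k then c (k - 2) else 0)) * g k)
     = (\<Sum>k\<le>n. a k * g k + b k * g (k + 1) + c k * g (k + 2))"
proof -
  have a: "(\<Sum>k\<le>n + 2. a k * g k) = (\<Sum>k\<le>n. a k * g k)"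
    by (rule sum.mono_neutral_right) (use assms in auto)
  have "(\<Sum>k\<le>n + 2. (if 1 \<le> k then b (k - 1) else 0) * g k) = (\<Sum>k\<le>n + 1. b k * g (k + 1))"
    by (simp add: sum.atMost_Suc_shift del: sum.atMost_Suc)
  also have "\<dots> = (\<Sum>k\<le>n. b k * g (k + 1))"
    by (rule sum.mono_neutral_right) (use assms in auto)
  finally have b: "(\<Sum>k\<le>n + 2. (if 1 \<le> k then b (k - 1) else 0) * g k) = (\<Sum>k\<le>n. b k * g (k + 1))" .
  have c: "(\<Sum>k\<le>n + 2. (if 2 \<le> k then c (k - 2) else 0) * g k) = (\<Sum>k\<le>n. c k * g (k + 2))"
    by (simp add: sum.atMost_Suc_shift del: sum.atMost_Suc)
  show ?thesis
    unfolding distrib_right sum.distrib a b c ..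
qed

text \<open>Induction on \<open>n\<close>: \<open>pairs_gf_Suc\<close> is carried over to numerators
  by \<open>gen_step_correct\<close>, and its expansion in the basis is the recursion of
  \<open>gamma_coeff\<close>. The base is the geometric series.\<close>

lemma pairs_gf_gamma: "(1 - fps_X)^(2 * n + 1) * pairs_gf n = (\<Sum>k\<le>n. fps_const (gamma_coeff n k) * gamma_basis n k)"
proof (induction n)
  case 0
  have "(1 - fps_X) * pairs_gf 0 = 1"
    by (rule fps_ext) (simp add: pairs_gf_def algebra_simps)
  then show ?case
    by (simp add: gamma_basis_def)
next
  case (Suc n)
  let ?c = "2 * of_nat (Suc n) :: rat"
  have "fps_const ?c * ((1 - fps_X)^(2 * Suc n + 1) * pairs_gf (Suc n))
     = gen_step (2 * n + 1) (2 * of_nat n) ((1 - fps_X)^(2 * n + 1) * pairs_gf n)"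
    unfolding gen_step_correct[symmetric] pairs_gf_Suc[symmetric] by (simp add: mult_ac)
  also have "\<dots> = (\<Sum>k\<le>n. fps_const (gamma_coeff n k) * gen_step (2 * n + 1) (2 * of_nat n) (gamma_basis n k))"
    unfolding Suc.IH gen_step_sum ..
  also have "\<dots> = (\<Sum>k\<le>n. fps_const (gamma_rec0 n k * gamma_coeff n k) * gamma_basis (Suc n) k 
       + fps_const (gamma_rec1 n k * gamma_coeff n k) * gamma_basis (Suc n) (k + 1)
       + fps_const (gamma_rec2 n k * gamma_coeff n k) * gamma_basis (Suc n) (k + 2))"
    by (rule sum.cong[OF refl], subst gen_step_gamma_basis) (simp_all add: distrib_left mult_ac flip: fps_const_mult)
  also have "\<dots> = (\<Sum>k\<le>n + 2. (fps_const (gamma_rec0 n k * gamma_coeff n k)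
       + (if 1 \<le> k then fps_const (gamma_rec1 n (k - 1) * gamma_coeff n (k - 1)) else 0)
       + (if 2 \<le> k then fps_const (gamma_rec2 n (k - 2) * gamma_coeff n (k - 2)) else 0)) * gamma_basis (Suc n) k)"
    by (rule sum_shifted_terms[symmetric]) (simp_all add: gamma_coeff_eq_0)
  also have "\<dots> = (\<Sum>k\<le>n + 2. fps_const (?c * gamma_coeff (Suc n) k) * gamma_basis (Suc n) k)"
    by (rule sum.cong) (simp_all add: gamma_coeff.simps(2))
  also have "\<dots> = (\<Sum>k\<le>Suc n. fps_const (?c * gamma_coeff (Suc n) k) * gamma_basis (Suc n) k)"
    by (rule sum.mono_neutral_right) (auto simp: gamma_coeff_eq_0)
  also have "\<dots> = fps_const ?c * (\<Sum>k\<le>Suc n. fps_const (gamma_coeff (Suc n) k) * gamma_basis (Suc n) k)"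
    unfolding sum_distrib_left by (rule sum.cong) (simp_all only: flip: fps_const_mult mult.assoc)
  finally show ?case
    by (simp del: of_nat_Suc sum.atMost_Suc)
qed

end

subsection \<open>Positivity of the gamma coefficients\<close>

lemma gamma_coeff_Suc_cleared:
  "2 * (of_nat n + 1) * gamma_coeff (Suc n) k = gamma_rec0 n k * gamma_coeff n k
     + (if 1 \<le> k then gamma_rec1 n (k - 1) * gamma_coeff n (k - 1) else 0)
     + (if 2 \<le> k then gamma_rec2 n (k - 2) * gamma_coeff n (k - 2) else 0)"
proof -
  have "2 * of_nat (Suc n) \<noteq> (0::rat)"
    by simp
  then show ?thesis
    by (simp add: gamma_coeff.simps(2) add.commute)
qed

lemma gamma_coeff_numeral:
  "gamma_coeff (numeral w) k = (gamma_rec0 (pred_numeral w) k * gamma_coeff (pred_numeral w) k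
     + (if 1 \<le> k then gamma_rec1 (pred_numeral w) (k - 1) * gamma_coeff (pred_numeral w) (k - 1) else 0)
     + (if 2 \<le> k then gamma_rec2 (pred_numeral w) (k - 2) * gamma_coeff (pred_numeral w) (k - 2) else 0)) / (2 * numeral w)"
proof -
  have "of_nat (Suc (pred_numeral w)) = (numeral w :: rat)"
    by (metis numeral_eq_Suc of_nat_numeral)
  then show ?thesis
    by (metis gamma_coeff.simps(2) numeral_eq_Suc)
qed

text \<open>Start of the positivity induction. Row 7 is already nonnegative, but row 8 ends in -583,
  so positivity persists only from row 9 on.\<close>

lemma gamma_coeff_9:
  shows "gamma_coeff 9 0 = 0" "gamma_coeff 9 1 = 1" "gamma_coeff 9 2 = 20" "gamma_coeff 9 3 = 728" "gamma_coeff 9 4 = 7902"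
    "gamma_coeff 9 5 = 50165" "gamma_coeff 9 6 = 122571" "gamma_coeff 9 7 = 135545" "gamma_coeff 9 8 = 33188"
    "gamma_coeff 9 9 = 4417"
proof -
  have g1: "gamma_coeff 1 0 = 0" "gamma_coeff 1 1 = 1"
    unfolding One_nat_def
    by (simp_all add: gamma_coeff.simps(2) gamma_rec0_def gamma_rec1_def gamma_rec2_def)
  have g2: "gamma_coeff 2 0 = 0" "gamma_coeff 2 1 = 1" "gamma_coeff 2 2 = -1"
    by (subst gamma_coeff_numeral, simp add: gamma_rec0_def gamma_rec1_def gamma_rec2_def g1[simplified] gamma_coeff_eq_0)+
  have g3: "gamma_coeff 3 0 = 0" "gamma_coeff 3 1 = 1" "gamma_coeff 3 2 = -1" "gamma_coeff 3 3 = 3"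
    by (subst gamma_coeff_numeral, simp add: gamma_rec0_def gamma_rec1_def gamma_rec2_def g2[simplified] gamma_coeff_eq_0)+
  have g4: "gamma_coeff 4 0 = 0" "gamma_coeff 4 1 = 1" "gamma_coeff 4 2 = 0" "gamma_coeff 4 3 = 12" "gamma_coeff 4 4 = -7"
    by (subst gamma_coeff_numeral, simp add: gamma_rec0_def gamma_rec1_def gamma_rec2_def g3[simplified] gamma_coeff_eq_0)+
  have g5: "gamma_coeff 5 0 = 0" "gamma_coeff 5 1 = 1" "gamma_coeff 5 2 = 2" "gamma_coeff 5 3 = 36" "gamma_coeff 5 4 = -10"
    "gamma_coeff 5 5 = 25"
    by (subst gamma_coeff_numeral, simp add: gamma_rec0_def gamma_rec1_def gamma_rec2_def g4[simplified] gamma_coeff_eq_0)+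
  have g6: "gamma_coeff 6 0 = 0" "gamma_coeff 6 1 = 1" "gamma_coeff 6 2 = 5" "gamma_coeff 6 3 = 91" "gamma_coeff 6 4 = 91"
    "gamma_coeff 6 5 = 219" "gamma_coeff 6 6 = -65"
    by (subst gamma_coeff_numeral, simp add: gamma_rec0_def gamma_rec1_def gamma_rec2_def g5[simplified] gamma_coeff_eq_0)+
  have g7: "gamma_coeff 7 0 = 0" "gamma_coeff 7 1 = 1" "gamma_coeff 7 2 = 9" "gamma_coeff 7 3 = 201" "gamma_coeff 7 4 = 652"
    "gamma_coeff 7 5 = 1710" "gamma_coeff 7 6 = 249" "gamma_coeff 7 7 = 283"
    by (subst gamma_coeff_numeral, simp add: gamma_rec0_def gamma_rec1_def gamma_rec2_def g6[simplified] gamma_coeff_eq_0)+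
  have g8: "gamma_coeff 8 0 = 0" "gamma_coeff 8 1 = 1" "gamma_coeff 8 2 = 14" "gamma_coeff 8 3 = 399" "gamma_coeff 8 4 = 2593"
    "gamma_coeff 8 5 = 10532" "gamma_coeff 8 6 = 11319" "gamma_coeff 8 7 = 6586" "gamma_coeff 8 8 = -583"
    by (subst gamma_coeff_numeral, simp add: gamma_rec0_def gamma_rec1_def gamma_rec2_def g7[simplified] gamma_coeff_eq_0)+
  show "gamma_coeff 9 0 = 0" "gamma_coeff 9 1 = 1" "gamma_coeff 9 2 = 20" "gamma_coeff 9 3 = 728" "gamma_coeff 9 4 = 7902"
    "gamma_coeff 9 5 = 50165" "gamma_coeff 9 6 = 122571" "gamma_coeff 9 7 = 135545" "gamma_coeff 9 8 = 33188" "gamma_coeff 9 9 = 4417"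
    by (subst gamma_coeff_numeral, simp add: gamma_rec0_def gamma_rec1_def gamma_rec2_def g8[simplified] gamma_coeff_eq_0)+
qed

text \<open>For \<open>k \<le> n\<close> the recurrence never meets the negative
  \<open>gamma_rec1 n n\<close>. Only the top coefficient of the next row needs a separate
  argument.\<close>

lemma gamma_coeff_Suc_nonneg:
  assumes "k \<le> n" "\<And>j. j \<le> n \<Longrightarrow> 0 \<le> gamma_coeff n j"
  shows "0 \<le> gamma_coeff (Suc n) k"
proof -
  have "0 \<le> gamma_rec0 n k * gamma_coeff n k"
    by (rule mult_nonneg_nonneg) (use assms in \<open>auto simp: gamma_rec0_def\<close>)
  moreover have "0 \<le> gamma_rec1 n (k - 1) * gamma_coeff n (k - 1)" if "1 \<le> k"
  proof (rule mult_nonneg_nonneg)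
    have "of_nat (k - 1) + 1 \<le> (of_nat n :: rat)"
      using that assms(1) by simp
    then show "0 \<le> gamma_rec1 n (k - 1)"
      unfolding gamma_rec1_def by (intro add_nonneg_nonneg mult_nonneg_nonneg) auto
  qed (use assms in auto)
  moreover have "0 \<le> gamma_rec2 n (k - 2) * gamma_coeff n (k - 2)" if "2 \<le> k"
  proof (rule mult_nonneg_nonneg)
    have "of_nat (k - 2) + 2 \<le> (of_nat n :: rat)"
      using that assms(1) by simp
    then show "0 \<le> gamma_rec2 n (k - 2)"
      unfolding gamma_rec2_def by (intro mult_nonneg_nonneg) auto
  qed (use assms in auto)
  ultimately show ?thesis
    by (simp add: gamma_coeff.simps(2))
qed

lemma atMost_upto_9: "{..9::nat} = {0,1,2,3,4,5,6,7,8,9}"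
  by auto

text \<open>The first inequality makes the next top coefficient nonnegative; the second is what
  reproduces the first.\<close>

lemma gamma_coeff_invariant:
  assumes "n \<ge> 9"
  shows "(\<forall>k\<le>n. 0 \<le> gamma_coeff n k) \<and> 4 * of_nat n * gamma_coeff n n \<le> 5 * gamma_coeff n (n - 1)
     \<and> of_nat n * gamma_coeff n (n - 1) \<le> 8 * gamma_coeff n (n - 2)"
  using assms
proof (induction n rule: dec_induct)
  case base
  have "\<forall>k\<in>{0,1,2,3,4,5,6,7,8,9}. 0 \<le> gamma_coeff 9 k"
    by (simp add: gamma_coeff_9[simplified])
  then have "\<forall>k\<le>9. 0 \<le> gamma_coeff 9 k"
    by (metis atMost_iff atMost_upto_9)
  then show ?case
    by (simp add: gamma_coeff_9[simplified])
next
  case (step n)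
  define m where "m = (of_nat n :: rat)"
  have m: "m \<ge> 9"
    using step.hyps by (simp add: m_def)
  define x y z w where "x = gamma_coeff n n" and "y = gamma_coeff n (n - 1)" and "z = gamma_coeff n (n - 2)" and "w = gamma_coeff n (n - 3)"
  have nonneg: "\<And>k. k \<le> n \<Longrightarrow> 0 \<le> gamma_coeff n k"
    and xy: "4 * m * x \<le> 5 * y" and yz: "m * y \<le> 8 * z"
    using step.IH by (auto simp: m_def x_def y_def z_def)
  have pos: "0 \<le> x" "0 \<le> y" "0 \<le> z" "0 \<le> w"
    using nonneg by (simp_all add: x_def y_def z_def w_def)
  have minus: "of_nat (n - 1) = m - 1" "of_nat (n - 2) = m - 2" "of_nat (n - 3) = m - 3"
    using step.hyps by (simp_all add: m_def of_nat_diff)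
  have idx: "n - 1 - 1 = n - 2" "n - 1 - 2 = n - 3" "1 \<le> n" "2 \<le> n" "1 \<le> n - 1" "2 \<le> n - 1"
    using step.hyps by auto
  \<comment> \<open>\<open>X\<close>, \<open>Y\<close> and \<open>Z\<close> are the recurrence at
    \<open>k = n + 1\<close>, \<open>n\<close> and \<open>n - 1\<close>, with the recurrence
    coefficients evaluated.\<close>
  have X: "2 * (m + 1) * gamma_coeff (Suc n) (Suc n) = 8 * y - (6 * m - 2) * x"
    unfolding m_def gamma_coeff_Suc_cleared using step.hyps minus
    by (simp add: gamma_coeff_eq_0 gamma_rec1_def gamma_rec2_def x_def y_def m_def algebra_simps)
  have Y: "2 * (m + 1) * gamma_coeff (Suc n) n = (m\<^sup>2 + 3 * m) * x + 2 * m * y + 48 * z"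
    unfolding m_def gamma_coeff_Suc_cleared using step.hyps minus
    by (simp add: gamma_rec0_def gamma_rec1_def gamma_rec2_def x_def y_def z_def m_def algebra_simps power2_eq_square)
  have Z: "2 * (m + 1) * gamma_coeff (Suc n) (n - 1) = (m\<^sup>2 + m) * y + (10 * m - 18) * z + 120 * w"
    unfolding m_def gamma_coeff_Suc_cleared idx using idx minus
    by (simp add: gamma_rec0_def gamma_rec1_def gamma_rec2_def y_def z_def w_def m_def algebra_simps power2_eq_square)
  have mx: "0 \<le> m * x" and my: "9 * y \<le> m * y" and mz: "9 * z \<le> m * z" 
    and mmy: "9 * (m * y) \<le> m * (m * y)"
    and mmx: "m * (4 * m * x) \<le> m * (5 * y)"
    using pos m xy by (simp_all add: mult_right_mono mult_left_mono)
  \<comment> \<open>By \<open>xy\<close>, \<open>6 m x\<close> is at most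
    \<open>15/2 y\<close>.\<close>
  have "0 \<le> 8 * y - (6 * m - 2) * x"
    using xy pos by (simp add: algebra_simps)
  then have "0 \<le> gamma_coeff (Suc n) (Suc n)"
    unfolding X[symmetric] using m by (simp add: zero_le_mult_iff)
  moreover have "0 \<le> gamma_coeff (Suc n) k" if "k \<le> n" for k
    by (rule gamma_coeff_Suc_nonneg) (use that nonneg in auto)
  moreover have "2 * (m + 1) * (4 * (m + 1) * gamma_coeff (Suc n) (Suc n)) \<le> 2 * (m + 1) * (5 * gamma_coeff (Suc n) n)"
  proof -
    \<comment> \<open>After dropping the terms in \<open>x\<close>, which have favourable signs,
      \<open>32 (m + 1) y \<le> 10 m y + 240 z\<close> remains. Here \<open>yz\<close> gives
      \<open>240 z \<ge> 30 m y\<close>, and \<open>m \<ge> 9\<close> suffices.\<close>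
    have "4 * (m + 1) * (8 * y - (6 * m - 2) * x) \<le> 5 * ((m\<^sup>2 + 3 * m) * x + 2 * m * y + 48 * z)"
    proof -
      have "0 \<le> (m + 1) * ((6 * m - 2) * x)" "0 \<le> (m\<^sup>2 + 3 * m) * x"
        using m pos by simp_all
      then show ?thesis
        using my yz pos by (simp add: algebra_simps power2_eq_square)
    qed
    then show ?thesis
      unfolding X[symmetric] Y[symmetric] by (simp add: mult_ac)
  qed
  moreover have "2 * (m + 1) * ((m + 1) * gamma_coeff (Suc n) n) \<le> 2 * (m + 1) * (8 * gamma_coeff (Suc n) (n - 1))"
  proof -
    \<comment> \<open>The inequality to be shown is scaled by 4 so that \<open>xy\<close> can trade
      \<open>4 m x\<close> for \<open>5 y\<close>. The terms in \<open>y\<close> and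
      \<open>z\<close> are then compared separately, and the one in \<open>w\<close> is
      dropped.\<close>
    have "4 * ((m + 1) * ((m\<^sup>2 + 3 * m) * x)) \<le> (m + 1) * (m + 3) * (5 * y)"
    proof -
      have "(m + 1) * (m + 3) * (4 * m * x) \<le> (m + 1) * (m + 3) * (5 * y)"
        by (rule mult_left_mono) (use xy m in auto)
      then show ?thesis
        by (simp add: algebra_simps power2_eq_square)
    qed
    moreover have "(m + 1) * (m + 3) * (5 * y) + 4 * ((m + 1) * (2 * m * y)) \<le> 4 * (8 * ((m\<^sup>2 + m) * y))"
      using mmy my pos by (simp add: algebra_simps power2_eq_square)
    moreover have "(m + 1) * (48 * z) \<le> 8 * ((10 * m - 18) * z)"
      using mz pos by (simp add: algebra_simps)
    ultimately have "(m + 1) * ((m\<^sup>2 + 3 * m) * x + 2 * m * y + 48 * z)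
        \<le> 8 * ((m\<^sup>2 + m) * y + (10 * m - 18) * z + 120 * w)"
      using pos unfolding distrib_left by linarith
    then show ?thesis
      unfolding Y[symmetric] Z[symmetric] by (simp add: mult_ac)
  qed
  ultimately have "\<forall>k\<le>Suc n. 0 \<le> gamma_coeff (Suc n) k"
    "4 * (m + 1) * gamma_coeff (Suc n) (Suc n) \<le> 5 * gamma_coeff (Suc n) n"
    "(m + 1) * gamma_coeff (Suc n) n \<le> 8 * gamma_coeff (Suc n) (n - 1)"
    using m by (auto simp: le_Suc_eq)
  then show ?case
    by (simp add: m_def add.commute)
qed

subsection \<open>Comparison of coefficients\<close>

text \<open>Valued in \<open>nat\<close>, so that the same numbers serve rational series and integer
  polynomials.\<close>

definition gamma_basis_coeff :: "nat \<Rightarrow> nat \<Rightarrow> nat \<Rightarrow> nat" where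
  "gamma_basis_coeff n k i = (if k \<le> i then (2 * n - 2 * k) choose (i - k) else 0)"

lemma coeff_one_plus_power: "coeff ([:1, 1:] ^ N) i = (of_nat (N choose i) :: 'a::comm_ring_1)"
proof (induction N arbitrary: i)
  case 0
  then show ?case by (cases i) auto
next
  case (Suc N)
  then show ?case by (cases i) (simp_all add: add.commute)
qed

lemma coeff_gamma_sum:
  fixes b :: "nat \<Rightarrow> 'a::comm_ring_1"
  shows "coeff (\<Sum>k\<in>S. smult (b k) (monom 1 k * [:1, 1:] ^ (2 * n - 2 * k))) i = (\<Sum>k\<in>S. b k * of_nat (gamma_basis_coeff n k i))"
  unfolding coeff_sum by (rule sum.cong) (auto simp: coeff_monom_mult coeff_one_plus_power gamma_basis_coeff_def)

context
  includes fps_syntax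
begin

lemma gamma_basis_nth: "gamma_basis n k $ i = of_nat (gamma_basis_coeff n k i)"
proof -
  have eq: "(1 + fps_X :: rat fps) = fps_of_poly [:1, 1:]"
    by (simp add: fps_of_poly_linear)
  have "((1 + fps_X) ^ N :: rat fps) $ j = of_nat (N choose j)" for N j
    by (simp only: eq fps_of_poly_power[symmetric] fps_of_poly_nth coeff_one_plus_power)
  then show ?thesis
    by (simp add: gamma_basis_def gamma_basis_coeff_def fps_X_power_mult_nth)
qed

text \<open>The negative binomial series shifted by \<open>d\<close>: an involution with
  \<open>d\<close> descents contributes \<open>X^d\<close> to the numerator.\<close>

lemma descent_gf:
  "(1 - fps_X) ^ (N + 1) * Abs_fps (\<lambda>r. if d \<le> r then of_nat ((r - d + N) choose N) else 0) = (fps_X ^ d :: rat fps)"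
proof -
  have "inverse ((1 - fps_X) ^ (N + 1) :: rat fps) = Abs_fps (\<lambda>r. of_nat ((r + N) choose N))"
    using one_minus_const_fps_X_neg_power'[of "N + 1" "1::rat"]
    by (simp add: binomial_symmetric[of N "_ + N"] add.commute[of N])
  moreover have "Abs_fps (\<lambda>r. if d \<le> r then of_nat ((r - d + N) choose N) else 0)
      = fps_X ^ d * Abs_fps (\<lambda>r. of_nat ((r + N) choose N) :: rat)"
    by (rule fps_ext) (auto simp: fps_X_power_mult_nth)
  moreover have "(1 - fps_X) ^ (N + 1) * inverse ((1 - fps_X) ^ (N + 1) :: rat fps) = 1"
    by (rule inverse_mult_eq_1') (simp add: fps_nth_power_0)
  ultimately show ?thesis
    by (metis mult.left_commute mult.right_neutral)
qed

text \<open>By \<open>sum_strict_at\<close> and \<open>descent_gf\<close>, the numerator of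
  \<open>pairs_gf n\<close> is the descent polynomial; \<open>pairs_gf_gamma\<close> expands the
  same numerator.\<close>

lemma coeff_J_poly_gamma_coeff: "of_int (coeff (J_poly (2 * n)) i) = (\<Sum>k\<le>n. gamma_coeff n k * of_nat (gamma_basis_coeff n k i))"
proof -
  let ?J = "fpf_involutions (2 * n)"
  let ?F = "\<lambda>\<pi>. Abs_fps (\<lambda>r. if des (2 * n) \<pi> \<le> r then of_nat ((r - des (2 * n) \<pi> + 2 * n) choose (2 * n)) else 0) :: rat fps"
  have "pairs_gf n = (\<Sum>\<pi>\<in>?J. ?F \<pi>)"
  proof (rule fps_ext)
    fix r
    have "pairs_gf n $ r = of_nat (\<Sum>\<pi>\<in>?J. if des (2 * n) \<pi> \<le> r
        then (r - des (2 * n) \<pi> + 2 * n) choose (2 * n) else 0)"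
      by (simp only: pairs_gf_def fps_nth_Abs_fps sum_strict_at)
    also have "\<dots> = (\<Sum>\<pi>\<in>?J. ?F \<pi>) $ r"
      unfolding of_nat_sum fps_sum_nth by (rule sum.cong) auto
    finally show "pairs_gf n $ r = (\<Sum>\<pi>\<in>?J. ?F \<pi>) $ r" .
  qed
  then have "(1 - fps_X) ^ (2 * n + 1) * pairs_gf n = (\<Sum>\<pi>\<in>?J. fps_X ^ des (2 * n) \<pi>)"
    by (simp only: sum_distrib_left descent_gf)
  then have "(\<Sum>\<pi>\<in>?J. fps_X ^ des (2 * n) \<pi>) $ i = (\<Sum>k\<le>n. fps_const (gamma_coeff n k) * gamma_basis n k) $ i"
    unfolding pairs_gf_gamma by simp
  moreover have "of_int (coeff (J_poly (2 * n)) i) = (\<Sum>\<pi>\<in>?J. fps_X ^ des (2 * n) \<pi> :: rat fps) $ i"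
    by (auto simp: J_poly_def coeff_sum fps_sum_nth intro: sum.cong)
  ultimately show ?thesis
    by (simp add: fps_sum_nth gamma_basis_nth)
qed

end

text \<open>The lowest term of \<open>t^k (1 + t)^(2n - 2k)\<close> is \<open>t^k\<close> with
  coefficient 1. This unitriangularity yields both integrality and uniqueness.\<close>

lemma gamma_basis_coeff_triangular:
  fixes c :: "nat \<Rightarrow> 'a::comm_ring_1"
  assumes "i \<le> n"
  shows "(\<Sum>k\<le>n. c k * of_nat (gamma_basis_coeff n k i)) = (\<Sum>k<i. c k * of_nat (gamma_basis_coeff n k i)) + c i"
proof -
  have "(\<Sum>k\<le>n. c k * of_nat (gamma_basis_coeff n k i)) = (\<Sum>k\<le>i. c k * of_nat (gamma_basis_coeff n k i))"
    by (rule sum.mono_neutral_right) (use assms in \<open>auto simp: gamma_basis_coeff_def\<close>)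
  then show ?thesis
    by (simp add: gamma_basis_coeff_def flip: lessThan_Suc_atMost)
qed

text \<open>Forward substitution in a unitriangular system with integer entries and integer
  right-hand side.\<close>

lemma gamma_coeff_in_Ints:
  assumes "k \<le> n"
  shows "gamma_coeff n k \<in> \<int>"
  using assms
proof (induction k rule: less_induct)
  case (less k)
  have "gamma_coeff n k = of_int (coeff (J_poly (2 * n)) k) - (\<Sum>j<k. gamma_coeff n j * of_nat (gamma_basis_coeff n j k))"
    using coeff_J_poly_gamma_coeff[of n k] gamma_basis_coeff_triangular[OF less.prems, of "gamma_coeff n"] by simp
  also have "\<dots> \<in> \<int>"
    using less by (intro Ints_diff Ints_sum Ints_mult) auto
  finally show ?case .
qed

lemma gamma_coeffs_unique:
  fixes c d :: "nat \<Rightarrow> 'a::comm_ring_1"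
  assumes "\<And>i. (\<Sum>k\<le>n. c k * of_nat (gamma_basis_coeff n k i)) = (\<Sum>k\<le>n. d k * of_nat (gamma_basis_coeff n k i))" "k \<le> n"
  shows "c k = d k"
  using \<open>k \<le> n\<close>
proof (induction k rule: less_induct)
  case (less k)
  have "(\<Sum>j<k. c j * of_nat (gamma_basis_coeff n j k)) = (\<Sum>j<k. d j * of_nat (gamma_basis_coeff n j k))"
    using less by (intro sum.cong) auto
  then show ?case
    using assms(1)[of k] gamma_basis_coeff_triangular[OF less.prems, of c] gamma_basis_coeff_triangular[OF less.prems, of d] by simp
qed

lemma gamma_basis_coeff_sym:
  assumes "k \<le> n" "i \<le> 2 * n"
  shows "gamma_basis_coeff n k (2 * n - i) = gamma_basis_coeff n k i"
proof (cases "k \<le> i \<and> i \<le> 2 * n - k")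
  case True
  then have "2 * n - i - k = 2 * n - 2 * k - (i - k)" "i - k \<le> 2 * n - 2 * k" "k \<le> 2 * n - i"
    using assms by auto
  then show ?thesis
    using True by (simp add: gamma_basis_coeff_def binomial_symmetric[of "i - k" "2 * n - 2 * k"])
qed (use assms in \<open>auto simp: gamma_basis_coeff_def\<close>)

text \<open>Inherited termwise from the symmetry of each basis element.\<close>

lemma palindromic_J_poly: "palindromic (2 * n) (J_poly (2 * n))"
  unfolding palindromic_def
proof (intro conjI allI impI)
  show "degree (J_poly (2 * n)) \<le> 2 * n"
  proof (rule degree_le, intro allI impI)
    fix i assume "2 * n < i"
    then have "(of_int (coeff (J_poly (2 * n)) i) :: rat) = 0"
      unfolding coeff_J_poly_gamma_coeff by (intro sum.neutral) (auto simp: gamma_basis_coeff_def)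
    then show "coeff (J_poly (2 * n)) i = 0"
      by simp
  qed
  fix i assume "i \<le> 2 * n"
  then have "(of_int (coeff (J_poly (2 * n)) i) :: rat) = of_int (coeff (J_poly (2 * n)) (2 * n - i))"
    unfolding coeff_J_poly_gamma_coeff by (intro sum.cong) (auto simp: gamma_basis_coeff_sym)
  then show "coeff (J_poly (2 * n)) i = coeff (J_poly (2 * n)) (2 * n - i)"
    by simp
qed

text \<open>The floors only change the type from \<open>rat\<close> to \<open>int\<close>, since
  their arguments are integers.\<close>

lemma J_poly_gamma_expansion:
  "J_poly (2 * n) = (\<Sum>k\<le>n. smult \<lfloor>gamma_coeff n k\<rfloor> (monom 1 k * [:1, 1:] ^ (2 * n - 2 * k)))"
proof (rule poly_eqI)
  fix i
  have "(of_int (coeff (J_poly (2 * n)) i) :: rat) = of_int (\<Sum>k\<le>n. \<lfloor>gamma_coeff n k\<rfloor> * of_nat (gamma_basis_coeff n k i))"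
    unfolding coeff_J_poly_gamma_coeff of_int_sum by (intro sum.cong) (auto simp: gamma_coeff_in_Ints)
  then show "coeff (J_poly (2 * n)) i = coeff (\<Sum>k\<le>n. smult \<lfloor>gamma_coeff n k\<rfloor> (monom 1 k * [:1, 1:] ^ (2 * n - 2 * k))) i"
    unfolding coeff_gamma_sum of_int_eq_iff .
qed

lemma sum_atMost_drop_0: 
  fixes f :: "nat \<Rightarrow> 'a::comm_monoid_add"
  assumes "f 0 = 0"
  shows "sum f {..n} = sum f {1..n}"
  by (rule sum.mono_neutral_right) (use assms in \<open>auto simp: not_less_eq_eq\<close>)

theorem theorem2:
  fixes n :: nat
  assumes "n \<ge> 9"
  shows "gamma_positive (2 * n) (J_poly (2 * n)) \<and>
    (\<exists>b :: nat \<Rightarrow> int. J_poly (2 * n) =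
        (\<Sum>k=1..n. smult (b k) (monom 1 k * [:1, 1:] ^ (2 * n - 2 * k)))) \<and>
    (\<forall>b :: nat \<Rightarrow> int. J_poly (2 * n) =
        (\<Sum>k=1..n. smult (b k) (monom 1 k * [:1, 1:] ^ (2 * n - 2 * k)))
      \<longrightarrow> (\<forall>k\<in>{1..n}. 0 \<le> b k))"
proof (intro conjI allI impI ballI)
  have nonneg: "0 \<le> gamma_coeff n k" if "k \<le> n" for k
    using gamma_coeff_invariant[OF assms] that by blast
  show "gamma_positive (2 * n) (J_poly (2 * n))"
    unfolding gamma_positive_def
  proof (intro conjI exI[of _ "\<lambda>k. \<lfloor>gamma_coeff n k\<rfloor>"] palindromic_J_poly)
    show "J_poly (2 * n) = (\<Sum>k\<le>2 * n div 2. smult \<lfloor>gamma_coeff n k\<rfloor> (monom 1 k * [:1, 1:] ^ (2 * n - 2 * k)))"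
      using J_poly_gamma_expansion[of n] by simp
  qed (simp add: nonneg)
  have "gamma_coeff n 0 = 0"
    using assms by (cases n) (auto simp: gamma_coeff_0_right)
  then show "\<exists>b :: nat \<Rightarrow> int. J_poly (2 * n) =
        (\<Sum>k=1..n. smult (b k) (monom 1 k * [:1, 1:] ^ (2 * n - 2 * k)))"
    using J_poly_gamma_expansion[of n] by (subst (asm) sum_atMost_drop_0) auto
  fix b :: "nat \<Rightarrow> int" and k
  assume b: "J_poly (2 * n) = (\<Sum>k=1..n. smult (b k) (monom 1 k * [:1, 1:] ^ (2 * n - 2 * k)))"
    and k: "k \<in> {1..n}"
  \<comment> \<open>Extending \<open>b\<close> by 0 at index 0 makes it comparable with
    \<open>gamma_coeff n\<close> over all of \<open>{..n}\<close>.\<close>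
  define c where "c j = (if j = 0 then 0 else rat_of_int (b j))" for j
  have "c k = gamma_coeff n k"
  proof (rule gamma_coeffs_unique)
    fix i
    have "(\<Sum>j\<le>n. c j * of_nat (gamma_basis_coeff n j i)) = (\<Sum>j=1..n. c j * of_nat (gamma_basis_coeff n j i))"
      by (rule sum_atMost_drop_0) (simp add: c_def)
    also have "\<dots> = of_int (coeff (J_poly (2 * n)) i)"
      unfolding b coeff_gamma_sum of_int_sum by (intro sum.cong) (auto simp: c_def)
    finally show "(\<Sum>j\<le>n. c j * of_nat (gamma_basis_coeff n j i)) = (\<Sum>j\<le>n. gamma_coeff n j * of_nat (gamma_basis_coeff n j i))"
      unfolding coeff_J_poly_gamma_coeff .
  qed (use k in simp)
  then show "0 \<le> b k"
    using nonneg[of k] k by (simp add: c_def)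
qed

end
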